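(* Let $L\in\mathbb{N}$ be such that $\sqrt{L\log L}\geq 55$. Then for all integers $g\geq L$, $$h(g) > e^{\frac{1}{4}\sqrt{\frac{g}{\log g}}}.$$
   Context: For a positive integer $g$, $\mathrm{Sp}(2g,\mathbb{Z})$ denotes the group of all $2g\times 2g$ integer matrices $A$ satisfying $A^{\top}JA=J$, where $J=\begin{pmatrix}0_g & I_g\\ -I_g & 0_g\end{pmatrix}$. The set $S(g)=\{m\in\mathbb{N}\mid \exists\, A\in \mathrm{Sp}(2g,\mathbb{Z}),\ A\neq 1,\ o(A)=m\}$ is the set of positive integers occurring as the (finite) order $o(A)$ of a non-identity element $A$; it is a finite nonempty set, and $h(g)=\max\{m\mid m\in S(g)\}$ is its largest element, i.e. the maximal finite order of an element of $\mathrm{Sp}(2g,\mathbb{Z})$. $\log$ is the natural logarithm. *)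

theory Defs
  imports "Jordan_Normal_Form.Determinant" "HOL-Algebra.Multiplicative_Group"
    Complex_Main
begin

definition symp_J :: "nat \<Rightarrow> int mat" where
  "symp_J g = four_block_mat (0\<^sub>m g g) (1\<^sub>m g) (- 1\<^sub>m g) (0\<^sub>m g g)"

definition Sp :: "nat \<Rightarrow> int mat monoid" where
  "Sp g = \<lparr>carrier = {A \<in> carrier_mat (2 * g) (2 * g). A\<^sup>T * symp_J g * A = symp_J g},
     mult = (*), one = 1\<^sub>m (2 * g)\<rparr>"

lemma symp_J_carrier [simp]: "symp_J g \<in> carrier_mat (2 * g) (2 * g)"
  by (auto simp: symp_J_def four_block_mat_def Let_def mult_2)

lemma symp_J_sq: "symp_J g * symp_J g = - 1\<^sub>m (2 * g)"
proof -
  have e: "1\<^sub>m (2 * g) = four_block_mat (1\<^sub>m g) (0\<^sub>m g g) (0\<^sub>m g g) (1\<^sub>m g :: int mat)"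
    by (simp add: mult_2)
  have "symp_J g * symp_J g =
      four_block_mat (- 1\<^sub>m g) (0\<^sub>m g g) (0\<^sub>m g g) (- 1\<^sub>m g)"
    unfolding symp_J_def by (subst mult_four_block_mat[where ?nr1.0=g and ?n1.0=g and ?n2.0=g and ?nr2.0=g and ?nc1.0=g and ?nc2.0=g]) auto
  also have "\<dots> = - 1\<^sub>m (2 * g)"
    unfolding e by (rule eq_matI) auto
  finally show ?thesis .
qed

text \<open>
  The order of an element is only meaningful in a group, so we check that \<open>Sp g\<close> is one.
\<close>

lemma group_Sp: "group (Sp g)"
proof (rule groupI)
  let ?n = "2 * g" and ?J = "symp_J g"
  note J = symp_J_carrier[of g]
  show "x \<otimes>\<^bsub>Sp g\<^esub> y \<in> carrier (Sp g)" if "x \<in> carrier (Sp g)" "y \<in> carrier (Sp g)" for x y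
  proof -
    from that have x: "x \<in> carrier_mat ?n ?n" "x\<^sup>T * ?J * x = ?J"
      and y: "y \<in> carrier_mat ?n ?n" "y\<^sup>T * ?J * y = ?J"
      by (auto simp: Sp_def)
    have "(x * y)\<^sup>T * ?J * (x * y) = y\<^sup>T * (x\<^sup>T * ?J * x) * y"
      using x(1) y(1) J
      by (simp add: transpose_mult assoc_mult_mat[of _ ?n ?n _ ?n _ ?n] mult_carrier_mat[of _ ?n ?n _ ?n])
    also have "\<dots> = ?J" using x y by simp
    finally show ?thesis using x y by (simp add: Sp_def)
  qed
  show "\<one>\<^bsub>Sp g\<^esub> \<in> carrier (Sp g)" by (simp add: Sp_def left_mult_one_mat[OF J] right_mult_one_mat[OF J])
  show "x \<otimes>\<^bsub>Sp g\<^esub> y \<otimes>\<^bsub>Sp g\<^esub> z = x \<otimes>\<^bsub>Sp g\<^esub> (y \<otimes>\<^bsub>Sp g\<^esub> z)"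
    if "x \<in> carrier (Sp g)" "y \<in> carrier (Sp g)" "z \<in> carrier (Sp g)" for x y z
    using that by (auto simp: Sp_def intro: assoc_mult_mat)
  show "\<one>\<^bsub>Sp g\<^esub> \<otimes>\<^bsub>Sp g\<^esub> x = x" if "x \<in> carrier (Sp g)" for x
    using that by (auto simp: Sp_def)
  show "\<exists>y\<in>carrier (Sp g). y \<otimes>\<^bsub>Sp g\<^esub> x = \<one>\<^bsub>Sp g\<^esub>" if "x \<in> carrier (Sp g)" for x
  proof -
    from that have x: "x \<in> carrier_mat ?n ?n" "x\<^sup>T * ?J * x = ?J"
      by (auto simp: Sp_def)
    define y where "y = - ?J * x\<^sup>T * ?J"
    have y: "y \<in> carrier_mat ?n ?n" using x(1) J by (simp add: y_def mult_carrier_mat[of _ ?n ?n _ ?n])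
    have "y * x = - ?J * (x\<^sup>T * ?J * x)"
      unfolding y_def using x(1) J
      by (simp add: assoc_mult_mat[of _ ?n ?n _ ?n _ ?n] mult_carrier_mat[of _ ?n ?n _ ?n])
    also have "\<dots> = 1\<^sub>m ?n" using x(2) carrier_matD[OF J] by (simp add: symp_J_sq)
    finally have yx: "y * x = 1\<^sub>m ?n" .
    let ?r = "map_mat rat_of_int"
    have "?r y * ?r x = 1\<^sub>m ?n"
      using yx x y of_int_hom.mat_hom_mult[OF y x(1), where ?'a=rat]
      by (simp add: of_int_hom.mat_hom_one)
    hence "?r x * ?r y = 1\<^sub>m ?n"
      by (rule mat_mult_left_right_inverse[rotated 2]) (use x y in auto)
    hence "?r (x * y) = ?r (1\<^sub>m ?n)"
      using x y of_int_hom.mat_hom_mult[OF x(1) y, where ?'a=rat]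
      by (simp add: of_int_hom.mat_hom_one)
    hence xy: "x * y = 1\<^sub>m ?n" by (simp add: of_int_hom.mat_hom_inj)
    have "y\<^sup>T * ?J * y = y\<^sup>T * (x\<^sup>T * ?J * x) * y" using x by simp
    also have "\<dots> = (x * y)\<^sup>T * ?J * (x * y)"
      using x(1) y J
      by (simp add: transpose_mult assoc_mult_mat[of _ ?n ?n _ ?n _ ?n] mult_carrier_mat[of _ ?n ?n _ ?n])
    also have "\<dots> = ?J" by (simp add: xy left_mult_one_mat[OF J] right_mult_one_mat[OF J])
    finally show ?thesis using y yx by (auto simp: Sp_def)
  qed
qed

text \<open>
  \<open>group.ord\<close> is \<open>0\<close> on elements of infinite order; the condition \<open>m > 0\<close> excludes these.
\<close>

definition Sp_orders :: "nat \<Rightarrow> nat set" where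
  "Sp_orders g = {m. m > 0 \<and> (\<exists>A \<in> carrier (Sp g). A \<noteq> \<one>\<^bsub>Sp g\<^esub> \<and> group.ord (Sp g) A = m)}"

definition max_Sp_order :: "nat \<Rightarrow> nat" where
  "max_Sp_order g = Max (Sp_orders g)"

end

theory Submission
  imports Defs "HOL-Library.Discrete_Functions" "HOL-Computational_Algebra.Primes" "HOL-Combinatorics.Cycles"
begin

text \<open>
  A permutation with disjoint cycles of lengths \<open>1, \<dots>, n\<close> has order \<open>Lcm {1..n} \<ge> 2 ^ (n - 1)\<close>, and
  two diagonal copies of its permutation matrix form a symplectic matrix of the same order as soon
  as \<open>n (n + 1) / 2 \<le> g\<close>. Already \<open>n = \<lfloor>sqrt g\<rfloor>\<close> beats the claimed bound. The maximum in \<open>max_Sp_order\<close>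
  is meaningful because, by Minkowski's argument, reduction modulo \<open>4\<close> is injective on the powers of
  an integer matrix of finite order.
\<close>

section \<open>Exponential growth of the least common multiple\<close>

text \<open>With \<open>a n k = k * (n choose k)\<close> one has \<open>1 / a n k = 1 / a (n + 1) k + 1 / a (n + 1) (k + 1)\<close>
  (Leibniz' harmonic triangle); multiplying by \<open>Lcm {1..n + 1}\<close> gives the induction step.\<close>

lemma times_binomial_dvd_Lcm:
  assumes "1 \<le> k" "k \<le> n"
  shows "k * (n choose k) dvd Lcm {1..n}"
  using assms
proof (induction n arbitrary: k)
  case 0
  then show ?case by simp
next
  case (Suc n)
  define D where "D = Lcm {1..Suc n}"
  \<comment> \<open>Inner induction along row \<open>n + 1\<close>: the entry at
    \<open>k + 1\<close> comes from its left neighbour and from the entry above that neighbour in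
    row \<open>n\<close>, which the outer induction covers.\<close>
  have "k * (Suc n choose k) dvd D" if "1 \<le> k" "k \<le> Suc n" for k
    using that
  proof (induction k rule: nat_induct_at_least)
    case base
    show ?case unfolding D_def by (auto intro!: dvd_Lcm simp del: Lcm_eq_0_I)
  next
    case (Suc k)
    have kn: "1 \<le> k" "k \<le> n" using Suc by auto
    have "Lcm {1..n} dvd D" unfolding D_def by (rule Lcm_subset) auto
    then have d1: "k * (n choose k) dvd D"
      using Suc.IH \<open>\<And>k. 1 \<le> k \<Longrightarrow> k \<le> n \<Longrightarrow> k * (n choose k) dvd Lcm {1..n}\<close>[OF kn] dvd_trans by blast
    have d2: "k * (Suc n choose k) dvd D" using Suc by auto
    define N where "N = real (n choose k)"
    have N: "N > 0" using kn by (simp add: N_def)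
    have "Suc k * (Suc n choose Suc k) = Suc n * (n choose k)"
      by (rule Suc_times_binomial)
    then have e1: "real (Suc k * (Suc n choose Suc k)) = real (Suc n) * N"
      by (simp only: N_def of_nat_mult)
    have "Suc n * (n choose k) = (Suc n - k) * (Suc n choose k)"
      using binomial_absorb_comp[of "Suc n" k] by simp
    then have "real (Suc n) * N = real (Suc n - k) * real (Suc n choose k)"
      by (metis N_def of_nat_mult)
    then have e2: "real (Suc n choose k) = real (Suc n) * N / (real (Suc n) - real k)"
      using kn by (simp add: field_simps of_nat_diff)
    have id: "real D / real (Suc k * (Suc n choose Suc k)) =
        real D / real (k * (n choose k)) - real D / real (k * (Suc n choose k))"
    proof -
      have "real D / (x * N) = real D / (y * N) - real D / (y * (x * N / (x - y)))"
        if "0 < y" "y < x" for x y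
        using that N by (simp add: divide_simps) (simp add: algebra_simps)
      from this[of "real k" "real (Suc n)"] show ?thesis
        using kn unfolding e1 of_nat_mult[of k] e2 N_def[symmetric] by simp
    qed
    obtain a where a: "D = k * (n choose k) * a" using d1 by (rule dvdE)
    obtain b where b: "D = k * (Suc n choose k) * b" using d2 by (rule dvdE)
    have "real D / real (k * (n choose k)) = real a"
      using kn by (subst a) simp
    moreover have "real D / real (k * (Suc n choose k)) = real b"
      using kn by (subst b) simp
    moreover define M where "M = Suc k * (Suc n choose Suc k)"
    ultimately have "real D / real M = real a - real b" using id by simp
    moreover have "M > 0" using kn unfolding M_def by (intro mult_pos_pos) auto
    ultimately have "real D = real M * (real a - real b)" by (simp add: field_simps)
    \<comment> \<open>The quotient is an integer; the step goes through \<open>int\<close> because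
      \<open>a - b\<close> would be truncated in \<open>nat\<close>.\<close>
    then have "real_of_int (int D) = real_of_int (int M * (int a - int b))" by simp
    then have "int D = int M * (int a - int b)" by (simp only: of_int_eq_iff)
    then have "int M dvd int D" by (rule dvdI)
    then show ?case by (simp only: M_def of_nat_dvd_iff)
  qed
  then show ?case using Suc.prems by (simp only: D_def)
qed

text \<open>Since \<open>(k + 1) * (n + 1 choose k + 1) = (n + 1) * (n choose k)\<close>, each
  number \<open>(n + 1) * (n choose k)\<close> divides the Lcm and so does not exceed it. Summing
  over the \<open>n + 1\<close> values of \<open>k\<close> turns the binomials into
  \<open>2 ^ n\<close>, and the factor \<open>n + 1\<close> cancels.\<close>

lemma power_le_Lcm: "2 ^ n \<le> Lcm {1..Suc n}"
proof -
  have "Suc n * (n choose k) \<le> Lcm {1..Suc n}" if "k \<le> n" for k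
  proof (rule dvd_imp_le)
    show "Suc n * (n choose k) dvd Lcm {1..Suc n}"
      using times_binomial_dvd_Lcm[of "Suc k" "Suc n"] that unfolding Suc_times_binomial by simp
  qed (auto intro!: Nat.gr0I simp: Lcm_0_iff)
  then have "(\<Sum>k\<le>n. Suc n * (n choose k)) \<le> (\<Sum>k\<le>n. Lcm {1..Suc n})"
    by (intro sum_mono) auto
  then have "Suc n * 2 ^ n \<le> Suc n * Lcm {1..Suc n}"
    by (simp only: sum_distrib_left[symmetric] choose_row_sum) simp
  then show ?thesis by (simp only: Suc_mult_le_cancel1)
qed

section \<open>Elements of finite order in the symplectic group\<close>

text \<open>This is the binomial expansion of \<open>(1 + X) ^ m\<close> cut off after the linear
  term: the rest contains \<open>X ^ 2\<close>, whose entries are multiples of \<open>d ^ 2\<close>.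
  With \<open>B = 1 + X\<close>, the induction uses
  \<open>B ^ (m + 1) = B ^ m + X + (B ^ m - 1) * X\<close>, where both factors of the last product
  are divisible by \<open>d\<close>.\<close>

lemma pow_mat_linear_approx:
  fixes X :: "int mat"
  assumes X: "X \<in> carrier_mat n n"
    and d: "\<And>i j. i < n \<Longrightarrow> j < n \<Longrightarrow> d dvd X $$ (i, j)"
    and "i < n" "j < n"
  shows "d\<^sup>2 dvd ((1\<^sub>m n + X) ^\<^sub>m m) $$ (i, j) - (1\<^sub>m n) $$ (i, j) - int m * X $$ (i, j)"
  using \<open>i < n\<close> \<open>j < n\<close>
proof (induction m arbitrary: i j)
  case 0
  then show ?case using X by simp
next
  case (Suc m)
  let ?B = "1\<^sub>m n + X"
  have B: "?B \<in> carrier_mat n n" using X by simp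
  define P where "P = ?B ^\<^sub>m m"
  have P: "P \<in> carrier_mat n n" using B by (simp add: P_def)
  have dP: "d dvd P $$ (i, l) - (1\<^sub>m n) $$ (i, l)" if "i < n" "l < n" for i l
  proof -
    have "d dvd P $$ (i, l) - (1\<^sub>m n) $$ (i, l) - int m * X $$ (i, l)"
      using Suc.IH[OF that] unfolding P_def power2_eq_square by (rule dvd_mult_left)
    then show ?thesis using d[OF that] by (metis diff_add_cancel dvd_add dvd_mult)
  qed
  have "?B ^\<^sub>m Suc m = P + P * X"
    using X P B by (simp add: P_def mult_add_distrib_mat[of _ n n _ n])
  also have "\<dots> = P + (X + (P - 1\<^sub>m n) * X)"
    using X P by (simp add: minus_mult_distrib_mat[of _ n n _ _ n])
      (intro eq_matI; auto)
  finally have eq: "(?B ^\<^sub>m Suc m) $$ (i, j) = P $$ (i, j) + X $$ (i, j) + ((P - 1\<^sub>m n) * X) $$ (i, j)"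
    using X P Suc.prems by simp
  have *: "d\<^sup>2 dvd ((P - 1\<^sub>m n) * X) $$ (i, j)"
  proof -
    have "((P - 1\<^sub>m n) * X) $$ (i, j) = (\<Sum>l<n. (P $$ (i, l) - (1\<^sub>m n) $$ (i, l)) * X $$ (l, j))"
      using X P Suc.prems by (simp add: scalar_prod_def atLeast0LessThan)
    also have "d\<^sup>2 dvd \<dots>"
      unfolding power2_eq_square using Suc.prems by (intro dvd_sum mult_dvd_mono dP d) auto
    finally show ?thesis .
  qed
  have "d\<^sup>2 dvd (P $$ (i, j) - (1\<^sub>m n) $$ (i, j) - int m * X $$ (i, j)) + ((P - 1\<^sub>m n) * X) $$ (i, j)"
    using Suc.IH[OF Suc.prems] * unfolding P_def by (intro dvd_add)
  then show ?case unfolding eq of_nat_Suc by (simp add: algebra_simps)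
qed

lemma pow_mat_add: "A \<in> carrier_mat n n \<Longrightarrow> A ^\<^sub>m (k + l) = A ^\<^sub>m k * A ^\<^sub>m l"
  for A :: "'a :: semiring_1 mat"
proof (induction l)
  case 0
  then show ?case by (simp add: right_mult_one_mat[of _ n n])
next
  case (Suc l)
  then show ?case by (simp add: assoc_mult_mat[of _ n n _ n _ n])
qed

lemma pow_mat_mult: "A \<in> carrier_mat n n \<Longrightarrow> A ^\<^sub>m (k * l) = (A ^\<^sub>m k) ^\<^sub>m l"
  for A :: "'a :: semiring_1 mat"
proof (induction l)
  case 0
  then show ?case by simp
next
  case (Suc l)
  have "A ^\<^sub>m (k * Suc l) = A ^\<^sub>m (k * l + k)" by (simp add: add.commute)
  then show ?case using Suc by (simp add: pow_mat_add[of A n])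
qed

text \<open>If \<open>2 ^ k\<close> divides \<open>X = B - 1\<close>, then \<open>B ^ m = 1\<close> forces \<open>2 ^ (2 * k)\<close> to divide \<open>m * X\<close>, hence
  \<open>2 ^ (2 * k - 1)\<close> to divide \<open>X\<close>. This gains a factor of \<open>2\<close> only for \<open>k \<ge> 2\<close>, whence the modulus \<open>4\<close>.\<close>

lemma pow_mat_eq_one_base:
  fixes B :: "int mat"
  assumes B: "B \<in> carrier_mat n n"
    and cong: "\<And>i j. i < n \<Longrightarrow> j < n \<Longrightarrow> 4 dvd (B - 1\<^sub>m n) $$ (i, j)"
    and pow: "B ^\<^sub>m m = 1\<^sub>m n" and m: "\<not> 4 dvd m"
  shows "B = 1\<^sub>m n"
proof -
  define X where "X = B - 1\<^sub>m n"
  have X: "X \<in> carrier_mat n n" using B by (simp add: X_def minus_carrier_mat)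
  have BX: "B = 1\<^sub>m n + X" unfolding X_def using B by (intro eq_matI) auto
  have step: "2 ^ (k + 2) dvd X $$ (i, j)" if "i < n" "j < n" for i j k
    using that
  proof (induction k arbitrary: i j)
    case 0
    then show ?case using cong by (simp add: X_def)
  next
    case (Suc k)
    have "(2 ^ (k + 2))\<^sup>2 dvd int m * X $$ (i, j)"
      using pow_mat_linear_approx[OF X Suc.IH Suc.prems, of m] pow Suc.prems by (simp add: BX)
    \<comment> \<open>The available exponent is \<open>2 * (k + 2) \<ge> k + 4\<close>. One factor 2
      beyond the desired \<open>2 ^ (k + 3)\<close> is kept, because an even \<open>m\<close> not
      divisible by 4 absorbs exactly one.\<close>
    then have dv: "2 * 2 ^ (k + 3) dvd int m * X $$ (i, j)"
      by (rule dvd_trans[rotated]) (auto simp: power_mult[symmetric] power_Suc[symmetric] simp del: power_Suc intro: le_imp_power_dvd)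
    show ?case
    proof (cases "even m")
      case False
      then have "coprime (2 * 2 ^ (k + 3)) (int m)" by simp
      then have "2 * 2 ^ (k + 3) dvd X $$ (i, j)" using dv coprime_dvd_mult_right_iff by blast
      then show ?thesis by (metis dvd_mult_right add.commute add_Suc_right eval_nat_numeral(3) numeral_2_eq_2)
    next
      case True
      then obtain m' where m': "m = 2 * m'" by blast
      with m have "odd m'" by auto
      then have "coprime (2 ^ (k + 3)) (int m')" by simp
      moreover have "2 ^ (k + 3) dvd int m' * X $$ (i, j)" using dv by (simp add: m' mult.assoc)
      ultimately have "2 ^ (k + 3) dvd X $$ (i, j)" using coprime_dvd_mult_right_iff by blast
      then show ?thesis by (simp add: eval_nat_numeral)
    qed
  qed
  \<comment> \<open>An entry divisible by every power of 2 vanishes: the exponent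
    \<open>\<bar>x\<bar> + 2\<close> already gives a power larger than
    \<open>\<bar>x\<bar>\<close>.\<close>
  have "X $$ (i, j) = 0" if "i < n" "j < n" for i j
  proof (rule ccontr)
    let ?x = "X $$ (i, j)"
    assume "?x \<noteq> 0"
    moreover have "2 ^ (nat \<bar>?x\<bar> + 2) dvd ?x" by (rule step[OF that])
    ultimately have "2 ^ (nat \<bar>?x\<bar> + 2) \<le> \<bar>?x\<bar>" by (metis dvd_imp_le_int abs_numeral power_abs)
    moreover have "int (nat \<bar>?x\<bar> + 2) < 2 ^ (nat \<bar>?x\<bar> + 2)" by (rule of_nat_less_two_power)
    ultimately show False by linarith
  qed
  then show ?thesis unfolding BX using X by (intro eq_matI) auto
qed

text \<open>Prime factors of \<open>m\<close> are stripped off one at a time. For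
  \<open>m = q * p\<close> with \<open>p\<close> prime, \<open>C = B ^ q\<close> is again congruent
  to 1 modulo 4 and \<open>C ^ p = 1\<close>. As 4 divides no prime, the preceding lemma yields
  \<open>C = 1\<close>, and the induction hypothesis applies to \<open>q < m\<close>.\<close>

lemma finite_order_cong_one_imp_eq_one:
  fixes B :: "int mat"
  assumes "B \<in> carrier_mat n n"
    and "\<And>i j. i < n \<Longrightarrow> j < n \<Longrightarrow> 4 dvd (B - 1\<^sub>m n) $$ (i, j)"
    and "B ^\<^sub>m m = 1\<^sub>m n" and "m > 0"
  shows "B = 1\<^sub>m n"
  using assms(3,4)
proof (induction m rule: less_induct)
  case (less m)
  note B = assms(1)
  show ?case
  proof (cases "m = 1")
    case True
    then show ?thesis using less B by simp
  next
    case False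
    then obtain p where p: "prime p" "p dvd m" using prime_factor_nat by blast
    then obtain q where q: "m = q * p" by (metis dvdE mult.commute)
    define C where "C = B ^\<^sub>m q"
    have C: "C \<in> carrier_mat n n" using B by (simp add: C_def)
    have "4 dvd (C - 1\<^sub>m n) $$ (i, j)" if ij: "i < n" "j < n" for i j
    proof -
      define X where "X = B - 1\<^sub>m n"
      have X: "X \<in> carrier_mat n n" using B by (simp add: X_def minus_carrier_mat)
      have BX: "B = 1\<^sub>m n + X" unfolding X_def using B by (intro eq_matI) auto
      have "4\<^sup>2 dvd C $$ (i, j) - (1\<^sub>m n) $$ (i, j) - int q * X $$ (i, j)"
        unfolding C_def BX by (rule pow_mat_linear_approx[OF X _ ij]) (use assms(2) in \<open>simp add: X_def\<close>)
      then have "4 dvd C $$ (i, j) - (1\<^sub>m n) $$ (i, j) - int q * X $$ (i, j)"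
        unfolding power2_eq_square by (rule dvd_mult_left)
      moreover have "4 dvd int q * X $$ (i, j)" using assms(2)[OF ij] by (simp add: X_def)
      ultimately have "4 dvd C $$ (i, j) - (1\<^sub>m n) $$ (i, j)" by (metis diff_add_cancel dvd_add)
      then show ?thesis using ij B C by simp
    qed
    moreover have "C ^\<^sub>m p = 1\<^sub>m n" using less.prems B by (simp add: C_def q pow_mat_mult)
    moreover have "\<not> 4 dvd p"
    proof
      assume "4 dvd p"
      then have "2 dvd p" by (metis dvd_trans even_numeral)
      then have "p = 2" using p(1) primes_dvd_imp_eq[OF two_is_prime_nat] by metis
      with \<open>4 dvd p\<close> show False by simp
    qed
    ultimately have "C = 1\<^sub>m n" by (intro pow_mat_eq_one_base[OF C])
    moreover have "0 < q" "q < m" using less.prems p(1) prime_gt_1_nat[OF p(1)] by (auto simp: q)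
    ultimately show ?thesis using less.IH by (simp add: C_def)
  qed
qed

section \<open>Boundedness of the finite orders\<close>

lemma Sp_pow: "A [^]\<^bsub>Sp g\<^esub> (k::nat) = A ^\<^sub>m k" if "A \<in> carrier (Sp g)"
proof (induction k)
  case 0
  then show ?case using that by (auto simp: Sp_def)
next
  case (Suc k)
  then show ?case by (simp add: Sp_def nat_pow_def)
qed

lemma cong_mult_mat:
  fixes A B C :: "int mat"
  assumes "A \<in> carrier_mat n n" "B \<in> carrier_mat n n" "C \<in> carrier_mat n n"
    and "\<And>i j. i < n \<Longrightarrow> j < n \<Longrightarrow> d dvd (A - B) $$ (i, j)"
    and "i < n" "j < n"
  shows "d dvd (A * C - B * C) $$ (i, j)"
proof -
  have "A * C - B * C = (A - B) * C"
    using assms by (simp add: minus_mult_distrib_mat[of _ n n _ _ n])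
  then have "(A * C - B * C) $$ (i, j) = (\<Sum>l<n. (A - B) $$ (i, l) * C $$ (l, j))"
    using assms by (simp add: scalar_prod_def atLeast0LessThan)
  also have "d dvd \<dots>" using assms by (intro dvd_sum dvd_mult2) auto
  finally show ?thesis .
qed

text \<open>The powers \<open>A ^ k\<close> with \<open>k < m\<close> of an element of order
  \<open>m\<close> are distinct modulo 4, so \<open>m\<close> is at most the number of matrices of
  residues modulo 4. Finiteness is what makes \<open>Max\<close> an upper bound.\<close>

lemma finite_Sp_orders: "finite (Sp_orders g)"
proof -
  interpret group "Sp g" by (rule group_Sp)
  define n where "n = 2 * g"
  define F :: "(nat \<times> nat \<Rightarrow> int) set" where "F = PiE ({..<n} \<times> {..<n}) (\<lambda>_. {0..<4})"
  have F: "finite F" unfolding F_def by (intro finite_PiE) auto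
  have "m \<le> card F" if mo: "m \<in> Sp_orders g" for m
  proof -
    obtain A where A: "A \<in> carrier (Sp g)" "ord A = m" and m: "m > 0"
      using mo by (auto simp: Sp_orders_def)
    have An: "A \<in> carrier_mat n n" using A by (simp add: Sp_def n_def)
    have one: "\<one>\<^bsub>Sp g\<^esub> = 1\<^sub>m n" by (simp add: Sp_def n_def)
    have Am: "A ^\<^sub>m m = 1\<^sub>m n" using pow_ord_eq_1[OF A(1)] by (simp add: Sp_pow A one)
    define r where "r k = restrict (\<lambda>ij. (A ^\<^sub>m k) $$ ij mod 4) ({..<n} \<times> {..<n})" for k
    have False if ab: "a < b" "b < m" "r a = r b" for a b
    proof -
      \<comment> \<open>\<open>C\<close> serves as the inverse of \<open>A ^ a\<close>. Multiplying
        the congruence between \<open>A ^ b\<close> and \<open>A ^ a\<close> by it shows that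
        \<open>D\<close> is congruent to 1 modulo 4, hence \<open>D = 1\<close>, against
        \<open>0 < b - a < m\<close>.\<close>
      define C where "C = A ^\<^sub>m (m - a)"
      define D where "D = A ^\<^sub>m (b - a)"
      have D: "D \<in> carrier_mat n n" using An by (simp add: D_def)
      have a: "A ^\<^sub>m a * C = 1\<^sub>m n" using ab An Am pow_mat_add[OF An, of a "m - a"] by (simp add: C_def)
      have "A ^\<^sub>m b * C = A ^\<^sub>m (b - a + m)"
        using ab An pow_mat_add[OF An, of b "m - a"] by (simp add: C_def add.commute)
      then have b: "A ^\<^sub>m b * C = D" using An Am pow_mat_add[OF An, of "b - a" m] by (simp add: D_def)
      have "4 dvd (A ^\<^sub>m b - A ^\<^sub>m a) $$ (i, j)" if "i < n" "j < n" for i j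
      proof -
        have "r a (i, j) = r b (i, j)" using ab by simp
        then show ?thesis using that An by (simp add: r_def mod_eq_dvd_iff dvd_diff_commute)
      qed
      then have "4 dvd (A ^\<^sub>m b * C - A ^\<^sub>m a * C) $$ (i, j)" if "i < n" "j < n" for i j
        using that An by (intro cong_mult_mat[of _ n]) (auto simp: C_def)
      moreover have "(1\<^sub>m n :: int mat) ^\<^sub>m k = 1\<^sub>m n" for k by (induction k) auto
      then have "D ^\<^sub>m m = 1\<^sub>m n"
        using pow_mat_mult[OF An, of m "b - a"] pow_mat_mult[OF An, of "b - a" m]
        by (simp add: D_def Am mult.commute)
      ultimately have "D = 1\<^sub>m n" using finite_order_cong_one_imp_eq_one[OF D] m by (simp add: a b)
      then have "A [^]\<^bsub>Sp g\<^esub> (b - a) = \<one>\<^bsub>Sp g\<^esub>" by (simp add: D_def Sp_pow A one)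
      then have "m dvd b - a" using A pow_eq_id by blast
      then show False using ab by (auto dest: dvd_imp_le)
    qed
    then have "inj_on r {..<m}" by (intro linorder_inj_onI) auto
    moreover have "r ` {..<m} \<subseteq> F" unfolding r_def F_def by (auto simp only: restrict_PiE_iff image_subset_iff) auto
    ultimately have "card {..<m} \<le> card F" using F by (intro card_inj_on_le)
    then show ?thesis by simp
  qed
  then have "Sp_orders g \<subseteq> {..card F}" by blast
  then show ?thesis by (rule finite_subset) simp
qed

section \<open>Permutation matrices\<close>

text \<open>For a permutation \<open>p\<close>, this orientation sends basis vector \<open>j\<close>
  to basis vector \<open>p j\<close>, so that matrix products follow the order of
  composition.\<close>

definition perm_mat :: "nat \<Rightarrow> (nat \<Rightarrow> nat) \<Rightarrow> int mat" where
  "perm_mat n p = mat n n (\<lambda>(i, j). if i = p j then 1 else 0)"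

lemma perm_mat_carrier [simp]: "perm_mat n p \<in> carrier_mat n n"
  by (simp add: perm_mat_def)

lemma perm_mat_id: "perm_mat n id = 1\<^sub>m n"
  by (auto simp: perm_mat_def)

lemma perm_mat_mult:
  assumes "q permutes {..<n}"
  shows "perm_mat n p * perm_mat n q = perm_mat n (p \<circ> q)"
proof (rule eq_matI)
  fix i j assume "i < dim_row (perm_mat n (p \<circ> q))" "j < dim_col (perm_mat n (p \<circ> q))"
  then have ij: "i < n" "j < n" by (auto simp: perm_mat_def)
  have q: "q j < n" using ij assms permutes_in_image[OF assms, of j] by simp
  have "(perm_mat n p * perm_mat n q) $$ (i, j) =
      (\<Sum>l<n. (if i = p l then 1 else 0) * (if l = q j then 1 else 0))"
    using ij by (simp add: perm_mat_def scalar_prod_def atLeast0LessThan)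
  also have "\<dots> = (\<Sum>l<n. if l = q j then (if i = p l then 1 else 0) else 0)"
    by (intro sum.cong) auto
  also have "\<dots> = perm_mat n (p \<circ> q) $$ (i, j)" using ij q by (simp add: perm_mat_def)
  finally show "(perm_mat n p * perm_mat n q) $$ (i, j) = perm_mat n (p \<circ> q) $$ (i, j)" .
qed (auto simp: perm_mat_def)

lemma transpose_perm_mat:
  assumes "p permutes {..<n}"
  shows "(perm_mat n p)\<^sup>T = perm_mat n (inv_into UNIV p)"
  by (rule eq_matI) (auto simp: perm_mat_def permutes_inverses[OF assms])

lemma perm_mat_pow: "p permutes {..<n} \<Longrightarrow> perm_mat n p ^\<^sub>m k = perm_mat n (p ^^ k)"
proof (induction k)
  case 0
  then show ?case using perm_mat_id by (simp add: perm_mat_def)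
next
  case (Suc k)
  then show ?case by (simp add: perm_mat_mult funpow_swap1 o_def)
qed

lemma perm_mat_eq_one_iff:
  assumes "p permutes {..<n}"
  shows "perm_mat n p = 1\<^sub>m n \<longleftrightarrow> p = id"
proof
  assume eq: "perm_mat n p = 1\<^sub>m n"
  have "p j = j" for j
  proof (cases "j < n")
    case True
    then have "p j < n" using permutes_in_image[OF assms, of j] by simp
    then have "perm_mat n p $$ (p j, j) = 1" using True by (simp add: perm_mat_def)
    then show ?thesis using True \<open>p j < n\<close> by (simp add: eq split: if_splits)
  next
    case False
    then show ?thesis using assms by (simp add: permutes_not_in)
  qed
  then show "p = id" by auto
qed (simp add: perm_mat_id)

section \<open>Orthogonal matrices inside the symplectic group\<close>

definition block_diag :: "nat \<Rightarrow> int mat \<Rightarrow> int mat" where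
  "block_diag n P = four_block_mat P (0\<^sub>m n n) (0\<^sub>m n n) P"

lemma block_diag_carrier: "P \<in> carrier_mat n n \<Longrightarrow> block_diag n P \<in> carrier_mat (2 * n) (2 * n)"
  unfolding block_diag_def mult_2 by (rule four_block_carrier_mat)

lemma block_diag_one: "block_diag n (1\<^sub>m n) = 1\<^sub>m (2 * n)"
  by (simp add: block_diag_def mult_2)

lemma block_diag_eq_one_iff:
  assumes "P \<in> carrier_mat n n"
  shows "block_diag n P = 1\<^sub>m (2 * n) \<longleftrightarrow> P = 1\<^sub>m n"
proof
  assume eq: "block_diag n P = 1\<^sub>m (2 * n)"
  show "P = 1\<^sub>m n"
  proof (rule eq_matI)
    fix i j assume "i < dim_row (1\<^sub>m n :: int mat)" "j < dim_col (1\<^sub>m n :: int mat)"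
    then have "block_diag n P $$ (i, j) = P $$ (i, j)" using assms by (simp add: block_diag_def)
    then show "P $$ (i, j) = 1\<^sub>m n $$ (i, j)"
      using eq \<open>i < _\<close> \<open>j < _\<close> by simp
  qed (use assms in auto)
qed (simp add: block_diag_one)

lemma block_diag_mult:
  assumes "P \<in> carrier_mat n n" "Q \<in> carrier_mat n n"
  shows "block_diag n P * block_diag n Q = block_diag n (P * Q)"
  unfolding block_diag_def using assms
  by (subst mult_four_block_mat[of _ n n _ n _ n _ _ n _ n]) auto

lemma block_diag_pow:
  assumes "P \<in> carrier_mat n n"
  shows "block_diag n P ^\<^sub>m k = block_diag n (P ^\<^sub>m k)"
proof (induction k)
  case 0
  then show ?case using assms block_diag_carrier[OF assms] by (simp add: block_diag_one)
next
  case (Suc k)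
  then show ?case using assms by (simp add: block_diag_mult)
qed

text \<open>The matrix with diagonal blocks \<open>P\<close> and the inverse transpose of
  \<open>P\<close> is always symplectic; for orthogonal \<open>P\<close> the two blocks
  coincide.\<close>

lemma block_diag_in_Sp:
  assumes P: "P \<in> carrier_mat g g" and orth: "P\<^sup>T * P = 1\<^sub>m g"
  shows "block_diag g P \<in> carrier (Sp g)"
proof -
  have "(block_diag g P)\<^sup>T = four_block_mat (P\<^sup>T) (0\<^sub>m g g) (0\<^sub>m g g) (P\<^sup>T)"
    unfolding block_diag_def using P by (subst transpose_four_block_mat) auto
  then have "(block_diag g P)\<^sup>T * symp_J g = four_block_mat (0\<^sub>m g g) (P\<^sup>T) (- P\<^sup>T) (0\<^sub>m g g)"
    unfolding symp_J_def using P
    by (simp, subst mult_four_block_mat[of _ g g _ g _ g _ _ g _ g]) auto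
  then have "(block_diag g P)\<^sup>T * symp_J g * block_diag g P = symp_J g"
    unfolding block_diag_def symp_J_def using P orth
    by (simp, subst mult_four_block_mat[of _ g g _ g _ g _ _ g _ g]) auto
  then show ?thesis using block_diag_carrier[OF P] by (simp add: Sp_def)
qed

section \<open>A permutation of large order\<close>

text \<open>A cycle of length \<open>n + 1\<close> is appended on the fresh block starting at
  \<open>t = 1 + ... + n\<close>; by disjointness a power is trivial iff it is trivial on both
  parts. Bijectivity is implicit in the second conjunct, because the power \<open>fact n\<close> is
  the identity.\<close>

lemma exists_perm_cycles:
  "\<exists>p. (\<forall>x\<ge>n * (n + 1) div 2. p x = x) \<and> (\<forall>k. p ^^ k = id \<longleftrightarrow> (\<forall>j\<in>{1..n}. j dvd k))"
proof (induction n)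
  case 0
  show ?case by (intro exI[of _ id] conjI) (simp, simp del: id_apply)
next
  case (Suc n)
  define t where "t = n * (n + 1) div 2"
  obtain p where p: "\<And>x. x \<ge> t \<Longrightarrow> p x = x" "\<And>k. p ^^ k = id \<longleftrightarrow> (\<forall>j\<in>{1..n}. j dvd k)"
    using Suc.IH unfolding t_def by blast
  \<comment> \<open>If \<open>p x \<ge> t\<close>, then \<open>p x\<close> is a fixed point and
    iteration never returns to \<open>x\<close>, although \<open>p ^^ fact n = id\<close>.\<close>
  have lt: "p x < t" if "x < t" for x
  proof (rule ccontr)
    assume "\<not> p x < t"
    then have px: "(p ^^ k) (p x) = p x" for k by (induction k) (auto simp: p)
    have f: "p ^^ fact n = id" by (subst p(2)) (auto intro: dvd_fact)
    have "x = (p ^^ fact n) x" by (simp add: f)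
    also have "\<dots> = (p ^^ (fact n - 1)) (p x)"
      by (metis fact_gt_zero Suc_diff_1 funpow_Suc_right o_apply)
    finally show False using px \<open>\<not> p x < t\<close> that by simp
  qed
  define q where "q = (\<lambda>x. if x < t then p x else if x < t + Suc n then t + (x - t + 1) mod Suc n else x)"
  have q_eq: "q x = (if x < t then p x else if x < t + Suc n then t + (x - t + 1) mod Suc n else x)" for x
    by (simp add: q_def)
  have q: "(q ^^ k) x = (if x < t then (p ^^ k) x else if x < t + Suc n then t + (x - t + k) mod Suc n else x)"
    for k x
  proof (induction k)
    case 0
    then show ?case by auto
  next
    case (Suc k)
    consider "x < t" | "t \<le> x" "x < t + Suc n" | "t + Suc n \<le> x" by linarith
    then show ?case
    proof cases
      case 1
      then have "(p ^^ k) x < t" by (induction k) (auto simp: lt)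
      then show ?thesis using 1 Suc by (simp add: q_eq)
    next
      case 2
      define r where "r = (x - t + k) mod Suc n"
      have "r < Suc n" by (simp add: r_def)
      moreover have "(q ^^ k) x = t + r" using Suc 2 by (simp add: r_def)
      ultimately have "(q ^^ Suc k) x = t + (r + 1) mod Suc n" by (simp add: q_eq)
      also have "(r + 1) mod Suc n = (x - t + Suc k) mod Suc n"
        unfolding r_def by (simp add: mod_Suc_eq)
      finally show ?thesis using 2 by simp
    next
      case 3
      then show ?thesis using Suc by (simp add: q_eq)
    qed
  qed
  have "q ^^ k = id \<longleftrightarrow> p ^^ k = id \<and> Suc n dvd k" for k
  proof
    assume a: "q ^^ k = id"
    \<comment> \<open>The first point of the new block has offset 0, so its image reads off
      \<open>k mod Suc n\<close>.\<close>
    have "(q ^^ k) t = t" by (simp add: a)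
    then have "Suc n dvd k" by (simp add: q mod_eq_0_iff_dvd)
    moreover have "(p ^^ k) x = x" for x
    proof (cases "x < t")
      case True
      then show ?thesis using q[of k x] by (simp add: a)
    next
      case False
      then show ?thesis by (induction k) (auto simp: p)
    qed
    ultimately show "p ^^ k = id \<and> Suc n dvd k" by auto
  next
    assume a: "p ^^ k = id \<and> Suc n dvd k"
    then have "(x - t + k) mod Suc n = x - t" if "x - t < Suc n" for x
      using that mod_add_right_eq[of "x - t" k "Suc n"] by simp
    then have "(q ^^ k) x = x" for x
      unfolding q using a by (auto simp del: add_Suc_right Nat.add_diff_assoc2)
    then show "q ^^ k = id" by auto
  qed
  then have "\<forall>k. q ^^ k = id \<longleftrightarrow> (\<forall>j\<in>{1..Suc n}. j dvd k)"
    by (auto simp: p atLeastAtMostSuc_conv)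
  moreover have "Suc n * (Suc n + 1) div 2 = t + Suc n" by (simp add: t_def)
  then have "\<forall>x\<ge>Suc n * (Suc n + 1) div 2. q x = x" by (auto simp: q_eq)
  ultimately show ?case by blast
qed

lemma Lcm_le_max_Sp_order:
  assumes n: "2 \<le> n" "n * (n + 1) div 2 \<le> g"
  shows "Lcm {1..n} \<le> max_Sp_order g"
proof -
  interpret group "Sp g" by (rule group_Sp)
  obtain p where p: "\<And>x. x \<ge> g \<Longrightarrow> p x = x" "\<And>k. p ^^ k = id \<longleftrightarrow> (\<forall>j\<in>{1..n}. j dvd k)"
    using exists_perm_cycles[of n] order_trans[OF n(2)] by blast
  \<comment> \<open>\<open>fact n\<close> is a common multiple of the cycle lengths, so
    \<open>p ^^ (fact n - 1)\<close> is a two-sided inverse of \<open>p\<close>.\<close>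
  have "p ^^ fact n = id" by (subst p(2)) (auto intro: dvd_fact)
  moreover have "(fact n :: nat) = Suc (fact n - 1)" by simp
  ultimately have "p \<circ> p ^^ (fact n - 1) = id" "p ^^ (fact n - 1) \<circ> p = id"
    by (metis funpow.simps(2), metis funpow_Suc_right)
  then have "bij p" by (intro o_bij)
  then have perm: "p permutes {..<g}" using p(1) unfolding permutes_def by (auto simp: bij_iff)
  define P where "P = perm_mat g p"
  have P: "P \<in> carrier_mat g g" by (simp add: P_def)
  have "P\<^sup>T * P = 1\<^sub>m g"
    unfolding P_def by (simp add: transpose_perm_mat[OF perm] perm_mat_mult[OF perm] permutes_inv_o[OF perm] perm_mat_id)
  define A where "A = block_diag g P"
  have A: "A \<in> carrier (Sp g)" unfolding A_def by (rule block_diag_in_Sp) fact+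
  have one: "\<one>\<^bsub>Sp g\<^esub> = 1\<^sub>m (2 * g)" by (simp add: Sp_def)
  have pow: "A [^]\<^bsub>Sp g\<^esub> k = \<one>\<^bsub>Sp g\<^esub> \<longleftrightarrow> (\<forall>j\<in>{1..n}. j dvd k)" for k :: nat
    unfolding Sp_pow[OF A] one unfolding A_def block_diag_pow[OF P]
    by (simp add: P_def block_diag_eq_one_iff perm_mat_pow[OF perm] perm_mat_eq_one_iff permutes_funpow[OF perm] p(2))
  \<comment> \<open>A natural number is determined by its set of multiples.\<close>
  have "ord A dvd k \<longleftrightarrow> Lcm {1..n} dvd k" for k
    using pow[of k] pow_eq_id[OF A, of k] by (simp add: Lcm_dvd_iff)
  then have ord: "ord A = Lcm {1..n}" by (meson dvd_antisym dvd_refl)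
  \<comment> \<open>Exponent 1 is not divisible by 2, one of the cycle lengths by
    \<open>2 \<le> n\<close>.\<close>
  have "A [^]\<^bsub>Sp g\<^esub> (1::nat) \<noteq> \<one>\<^bsub>Sp g\<^esub>" unfolding pow using n by (auto intro!: bexI[of _ 2])
  then have "A \<noteq> \<one>\<^bsub>Sp g\<^esub>" by auto
  moreover have "Lcm {1..n} > 0" by (auto intro!: Nat.gr0I simp: Lcm_0_iff)
  ultimately have "Lcm {1..n} \<in> Sp_orders g" using A ord by (auto simp: Sp_orders_def)
  then show ?thesis unfolding max_Sp_order_def by (intro Max_ge finite_Sp_orders)
qed

section \<open>Comparison with the claimed bound\<close>

theorem corollary3p8:
  fixes L :: nat
  assumes "sqrt (real L * ln (real L)) \<ge> 55"
  shows "\<forall>g\<ge>L. real (max_Sp_order g) > exp (1 / 4 * sqrt (real g / ln (real g)))"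
proof (intro allI impI)
  fix g assume g: "g \<ge> L"
  \<comment> \<open>For \<open>L \<le> 8\<close> the root would be at most 8. The case
    \<open>L = 0\<close> is split off since \<open>ln x \<le> x - 1\<close> requires
    \<open>x > 0\<close>.\<close>
  have "L \<ge> 9"
  proof (rule ccontr)
    assume "\<not> L \<ge> 9"
    then have L: "real L \<le> 8" by simp
    have "ln (real L) \<le> 8" using L ln_le_minus_one[of "real L"] by (cases "L = 0") auto
    then have "real L * ln (real L) \<le> 8 * 8"
      using L by (cases "L = 0", simp, intro mult_mono) auto
    then have "sqrt (real L * ln (real L)) \<le> sqrt (8 * 8)" by (rule real_sqrt_le_mono)
    with assms show False by simp
  qed
  with g have g9: "g \<ge> 9" by simp
  define n where "n = floor_sqrt g"
  have "3\<^sup>2 \<le> g" using g9 by simp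
  then have n3: "n \<ge> 3" unfolding n_def by (simp add: le_floor_sqrt_iff)
  have n2: "n\<^sup>2 \<le> g" by (simp add: n_def)
  have "n * (n + 1) \<le> n * (2 * n)" using n3 by (intro mult_left_mono) auto
  then have "n * (n + 1) div 2 \<le> n\<^sup>2" unfolding power2_eq_square by linarith
  then have "2 ^ (n - 1) \<le> max_Sp_order g"
    using Lcm_le_max_Sp_order[of n g] power_le_Lcm[of "n - 1"] n2 n3 by simp
  then have h: "2 ^ (n - 1) \<le> real (max_Sp_order g)" by (metis of_nat_le_iff of_nat_numeral of_nat_power)
  \<comment> \<open>From \<open>g \<ge> 9 > exp 1\<close>; the denominator \<open>ln g\<close> can
    then be dropped.\<close>
  have "ln (real g) \<ge> 1"
    using g9 exp_le by (subst ln_ge_iff) auto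
  then have "sqrt (real g / ln (real g)) \<le> sqrt (real g)"
    using g9 by (intro real_sqrt_le_mono) (simp add: field_simps)
  also have "\<dots> < real n + 1"
  proof (rule real_less_lsqrt)
    have "g < (Suc n)\<^sup>2" unfolding n_def by (rule Suc_floor_sqrt_power2_gt)
    then show "real g < (real n + 1)\<^sup>2" by (metis of_nat_Suc of_nat_less_iff of_nat_power add.commute)
  qed auto
  \<comment> \<open>Equivalent to \<open>n \<ge> 3\<close>, with equality at 3. The constant
    \<open>1 / 2\<close> is a lower bound for \<open>ln 2\<close>, obtained from
    \<open>ln (1 / 2) \<le> - 1 / 2\<close>.\<close>
  also have "real n + 1 \<le> 4 * ((real n - 1) * (1 / 2))" using n3 by simp
  also have "\<dots> \<le> 4 * ((real n - 1) * ln 2)"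
    using n3 ln_le_minus_one[of "1 / 2"] by (intro mult_left_mono) (auto simp: ln_div)
  finally have "1 / 4 * sqrt (real g / ln (real g)) < real (n - 1) * ln 2" using n3 by (simp add: of_nat_diff)
  then have "exp (1 / 4 * sqrt (real g / ln (real g))) < exp (real (n - 1) * ln 2)" by simp
  also have "\<dots> = 2 ^ (n - 1)" by (simp add: exp_of_nat_mult)
  finally show "real (max_Sp_order g) > exp (1 / 4 * sqrt (real g / ln (real g)))" using h by (rule less_le_trans)
qed

end
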